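(* Let $\Delta$ be an arbitrary triangle of area $1$, let $s$ be one of its sides, and let $\Delta'$ be the Steiner symmetrization of $\Delta$ performed parallel to $s$ (i.e. with respect to a line perpendicular to $s$). Then this symmetrization increases $\rho_1$: $\rho_1(\Delta')>\rho_1(\Delta)$ unless $\Delta$ is already isosceles with base $s$ (in which case $\Delta'$ is congruent to $\Delta$). Consequently, for every fixed area, the equilateral triangle is the unique (up to congruence) maximizer of $\rho_1$ among all triangles of that area.
   Context: For a bounded simply connected region $\Omega\subseteq\mathbb{C}$ and $N\in\mathbb{N}$, let $\mathcal{P}_N$ be the space of complex polynomials in $z$ of degree at most $N$, and let $dA$ denote area measure. Define $$\rho_N(\Omega):=\min_{p\in\mathcal{P}_N}\int_\Omega|\bar z-p(z)|^2\,dA(z),$$ the square of the distance from $\bar z$ to $\mathcal{P}_N$ in $L^2(\Omega,dA)$. Steiner symmetrization of $\Omega$ with respect to a line $\ell$ replaces, for every line $\ell'$ perpendicular to $\ell$ that meets $\Omega$, the intersection $\ell'\cap\Omega$ by a line segment contained in $\ell'$, centered on $\ell$, and having length equal to the one-dimensional Lebesgue measure of $\ell'\cap\Omega$. The base of an isosceles triangle is the side whose two adjacent sides have equal length; in an equilateral triangle any side may be considered as the base. Triangles are regarded as regions in $\mathbb{C}\cong\mathbb{R}^2$. *)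

theory Defs
  imports "HOL-Analysis.Analysis" "HOL-Computational_Algebra.Polynomial"
begin

text \<open>The infimum below is the squared distance from \<open>cnj z\<close> to a finite-dimensional subspace
  of \<open>L\<^sup>2(\<Omega>)\<close>, hence it is attained whenever \<open>\<Omega>\<close> is bounded and measurable.\<close>

definition rho :: "nat \<Rightarrow> complex set \<Rightarrow> real" where
  "rho N \<Omega> = (INF p\<in>{p :: complex poly. degree p \<le> N}.
     (LINT z:\<Omega>|lborel. (cmod (cnj z - poly p z))\<^sup>2))"

text \<open>Symmetrization with respect to the line through \<open>q\<close> with direction \<open>v \<noteq> 0\<close>;
  \<open>\<i> * sgn v\<close> is a unit normal of that line. The segments that replace the slices are taken open,
  so that regions (open sets) are mapped to regions.\<close>

definition steiner :: "complex \<Rightarrow> complex \<Rightarrow> complex set \<Rightarrow> complex set" where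
  "steiner q v \<Omega> = {q + s *\<^sub>R v + t *\<^sub>R (\<i> * sgn v) | s t.
     (\<exists>\<tau>. q + s *\<^sub>R v + \<tau> *\<^sub>R (\<i> * sgn v) \<in> \<Omega>) \<and>
     \<bar>t\<bar> < measure lborel {\<tau> :: real. q + s *\<^sub>R v + \<tau> *\<^sub>R (\<i> * sgn v) \<in> \<Omega>} / 2}"

definition tri :: "complex \<Rightarrow> complex \<Rightarrow> complex \<Rightarrow> complex set" where
  "tri a b c = interior (convex hull {a, b, c})"

definition is_triangle :: "complex set \<Rightarrow> bool" where
  "is_triangle T \<longleftrightarrow> (\<exists>a b c. \<not> collinear {a, b, c} \<and> T = tri a b c)"

definition equilateral_triangle :: "complex set \<Rightarrow> bool" where
  "equilateral_triangle T \<longleftrightarrow>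
     (\<exists>a b c. \<not> collinear {a, b, c} \<and> dist a b = dist b c \<and> dist b c = dist c a \<and> T = tri a b c)"

abbreviation area :: "complex set \<Rightarrow> real" where
  "area \<equiv> measure lborel"

definition congruent_sets :: "complex set \<Rightarrow> complex set \<Rightarrow> bool" where
  "congruent_sets S T \<longleftrightarrow>
     (\<exists>f :: complex \<Rightarrow> complex. (\<forall>x y. dist (f x) (f y) = dist x y) \<and> f ` S = T)"

end

theory Submission
  imports Defs
begin

text \<open>
  Write \<open>D\<close> for twice the signed area of a triangle and \<open>S\<close> for the sum of its squared side
  lengths. If \<open>h\<close> is real-affine, the integral of \<open>|h|\<^sup>2\<close> over the triangle is \<open>|D| / 24\<close> times the sum
  of \<open>|h|\<^sup>2\<close> at the vertices and of \<open>|h(a) + h(b) + h(c)|\<^sup>2\<close>. Applying this to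
  \<open>h(z) = cnj z - \<alpha> - \<beta> z\<close>, with the centroid moved to the origin, and completing the square in
  \<open>\<alpha>\<close> and \<open>\<beta>\<close> gives \<open>rho 1 = |D|\<^sup>3 / (6 S)\<close>. So for fixed area \<open>rho 1\<close> decreases in \<open>S\<close>.
  Symmetrizing parallel to a side keeps this side and the height, and among such triangles
  the isosceles one has the smallest \<open>S\<close>. Heron's formula turns into
  \<open>S\<^sup>2 = 12 D\<^sup>2 + 2 ((x - y)\<^sup>2 + (y - z)\<^sup>2 + (z - x)\<^sup>2)\<close> for the squared sides \<open>x, y, z\<close>, so \<open>S\<close> is
  minimal exactly for equilateral triangles.
\<close>

subsection \<open>Affine substitution in the plane\<close>

text \<open>Lebesgue measure is determined by its values on boxes, and under \<open>Complex\<close>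
  a box pulls back to a product of two intervals. This opens the way to iterated integrals over
  \<open>complex\<close>, which is not a product type.\<close>

lemma lborel_complex_eq_distr:
  "(lborel :: complex measure) = distr (lborel \<Otimes>\<^sub>M lborel) borel (\<lambda>(x, y). Complex x y)"
proof (rule lborel_eqI)
  fix l u :: complex
  assume lu: "\<And>b. b \<in> Basis \<Longrightarrow> l \<bullet> b \<le> u \<bullet> b"
  have le: "Re l \<le> Re u" "Im l \<le> Im u"
    using lu[of 1] lu[of \<i>] by (auto simp: Basis_complex_def)
  have meas: "(\<lambda>(x, y). Complex x y) \<in> borel_measurable (lborel \<Otimes>\<^sub>M lborel)"
    unfolding Complex_eq case_prod_beta by measurable
  have pre: "(\<lambda>(x, y). Complex x y) -` box l u \<inter> space (lborel \<Otimes>\<^sub>M lborel)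
      = {Re l<..<Re u} \<times> {Im l<..<Im u}"
    by (auto simp: box_def Basis_complex_def space_pair_measure)
  show "emeasure (distr (lborel \<Otimes>\<^sub>M lborel) borel (\<lambda>(x, y). Complex x y)) (box l u) =
      ennreal (\<Prod>b\<in>Basis. (u - l) \<bullet> b)"
    using le by (simp add: emeasure_distr[OF meas] pre lborel.emeasure_pair_measure_Times
        Basis_complex_def flip: ennreal_mult)
qed simp

lemma borel_measurable_Complex [measurable]:
  assumes [measurable]: "f \<in> borel_measurable M" "g \<in> borel_measurable M"
  shows "(\<lambda>x. Complex (f x) (g x)) \<in> borel_measurable M"
  unfolding Complex_eq by measurable

lemma nn_integral_complex:
  fixes f :: "complex \<Rightarrow> ennreal"
  assumes [measurable]: "f \<in> borel_measurable borel"
  shows "(\<integral>\<^sup>+z. f z \<partial>lborel) = (\<integral>\<^sup>+x. \<integral>\<^sup>+y. f (Complex x y) \<partial>lborel \<partial>lborel)"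
  by (subst lborel_complex_eq_distr)
    (simp add: nn_integral_distr case_prod_beta flip: lborel.nn_integral_fst)

text \<open>The real determinant with columns \<open>u\<close> and \<open>w\<close>: twice the
  signed area of the triangle 0, \<open>u\<close>, \<open>w\<close>, and the Jacobian of the map
  sending (s, t) to s u + t w.\<close>

definition cross :: "complex \<Rightarrow> complex \<Rightarrow> real" where
  "cross u w = Im (cnj u * w)"

text \<open>The substitution is carried out one coordinate at a time: first \<open>s\<close> is replaced by the real
  part, then, after exchanging the integrals, \<open>t\<close> by the imaginary part.\<close>

lemma nn_integral_complex_affine_aux:
  fixes f :: "complex \<Rightarrow> ennreal" and u w :: complex
  assumes [measurable]: "f \<in> borel_measurable borel"
    and D: "cross u w \<noteq> 0" and u: "Re u \<noteq> 0"
  shows "(\<integral>\<^sup>+z. f z \<partial>lborel) =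
    ennreal \<bar>cross u w\<bar> * (\<integral>\<^sup>+t. \<integral>\<^sup>+s. f (a + s *\<^sub>R u + t *\<^sub>R w) \<partial>lborel \<partial>lborel)"
proof -
  \<comment> \<open>With the real part of \<open>a + s *\<^sub>R u + t *\<^sub>R w\<close> held
    fixed, its imaginary part changes at rate \<open>k\<close> in \<open>t\<close>. The Jacobian
    thus splits into the factors \<open>Re u\<close> and \<open>k\<close>, one for each
    substitution.\<close>
  define k where "k = cross u w / Re u"
  have k: "k \<noteq> 0" using D u by (simp add: k_def)
  have "(\<integral>\<^sup>+t. \<integral>\<^sup>+s. f (a + s *\<^sub>R u + t *\<^sub>R w) \<partial>lborel \<partial>lborel) =
    (\<integral>\<^sup>+t. ennreal \<bar>1 / Re u\<bar> * (\<integral>\<^sup>+x. f (Complex x (Im a + (x - Re a) * Im u / Re u + k * t)) \<partial>lborel) \<partial>lborel)"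
  proof (intro nn_integral_cong)
    fix t :: real
    have "(\<integral>\<^sup>+s. f (a + s *\<^sub>R u + t *\<^sub>R w) \<partial>lborel) = ennreal \<bar>1 / Re u\<bar> *
       (\<integral>\<^sup>+x. f (a + (- (Re a + t * Re w) / Re u + (1 / Re u) * x) *\<^sub>R u + t *\<^sub>R w) \<partial>lborel)"
      using u by (intro nn_integral_real_affine) auto
    moreover have "a + (- (Re a + t * Re w) / Re u + (1 / Re u) * x) *\<^sub>R u + t *\<^sub>R w
       = Complex x (Im a + (x - Re a) * Im u / Re u + k * t)" for x
      using u by (auto simp: complex_eq_iff k_def cross_def field_simps)
    ultimately show "(\<integral>\<^sup>+s. f (a + s *\<^sub>R u + t *\<^sub>R w) \<partial>lborel) = ennreal \<bar>1 / Re u\<bar> *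
       (\<integral>\<^sup>+x. f (Complex x (Im a + (x - Re a) * Im u / Re u + k * t)) \<partial>lborel)" by simp
  qed
  also have "\<dots> = ennreal \<bar>1 / Re u\<bar> *
      (\<integral>\<^sup>+x. \<integral>\<^sup>+t. f (Complex x (Im a + (x - Re a) * Im u / Re u + k * t)) \<partial>lborel \<partial>lborel)"
    by (subst nn_integral_cmult, measurable) (subst lborel_pair.Fubini', simp_all)
  finally have 1: "(\<integral>\<^sup>+t. \<integral>\<^sup>+s. f (a + s *\<^sub>R u + t *\<^sub>R w) \<partial>lborel \<partial>lborel) = \<dots>" .
  have "(\<integral>\<^sup>+z. f z \<partial>lborel) = (\<integral>\<^sup>+x. ennreal \<bar>k\<bar> *
      (\<integral>\<^sup>+t. f (Complex x (Im a + (x - Re a) * Im u / Re u + k * t)) \<partial>lborel) \<partial>lborel)"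
    unfolding nn_integral_complex[OF assms(1)]
    using k by (intro nn_integral_cong nn_integral_real_affine) auto
  also have "\<dots> = ennreal \<bar>k\<bar> *
      (\<integral>\<^sup>+x. \<integral>\<^sup>+t. f (Complex x (Im a + (x - Re a) * Im u / Re u + k * t)) \<partial>lborel \<partial>lborel)"
    by (rule nn_integral_cmult) measurable
  also have "ennreal \<bar>k\<bar> = ennreal \<bar>cross u w\<bar> * ennreal \<bar>1 / Re u\<bar>"
    by (simp add: k_def abs_mult flip: ennreal_mult'')
  finally show ?thesis unfolding 1 by (simp add: mult.assoc)
qed

lemma cross_commute: "cross u w = - cross w u"
  by (simp add: cross_def)

lemma nn_integral_complex_affine:
  fixes f :: "complex \<Rightarrow> ennreal" and u w :: complex
  assumes f [measurable]: "f \<in> borel_measurable borel" and D: "cross u w \<noteq> 0"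
  shows "(\<integral>\<^sup>+z. f z \<partial>lborel) =
    ennreal \<bar>cross u w\<bar> * (\<integral>\<^sup>+t. \<integral>\<^sup>+s. f (a + s *\<^sub>R u + t *\<^sub>R w) \<partial>lborel \<partial>lborel)"
proof (cases "Re u = 0")
  case False
  then show ?thesis using nn_integral_complex_affine_aux[OF f D] by blast
next
  case True
  \<comment> \<open>A nonzero determinant forces \<open>Re w\<close> to be nonzero, so the previous
    case applies with \<open>u\<close> and \<open>w\<close> exchanged; the determinant only changes
    its sign.\<close>
  then have "Re w \<noteq> 0" "cross w u \<noteq> 0" using D by (auto simp: cross_def)
  then have "(\<integral>\<^sup>+z. f z \<partial>lborel) =
    ennreal \<bar>cross w u\<bar> * (\<integral>\<^sup>+s. \<integral>\<^sup>+t. f (a + t *\<^sub>R w + s *\<^sub>R u) \<partial>lborel \<partial>lborel)"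
    by (intro nn_integral_complex_affine_aux) auto
  also have "(\<integral>\<^sup>+s. \<integral>\<^sup>+t. f (a + t *\<^sub>R w + s *\<^sub>R u) \<partial>lborel \<partial>lborel)
    = (\<integral>\<^sup>+t. \<integral>\<^sup>+s. f (a + s *\<^sub>R u + t *\<^sub>R w) \<partial>lborel \<partial>lborel)"
    by (subst lborel_pair.Fubini') (simp_all add: add_ac)
  finally show ?thesis by (simp add: cross_commute[of w])
qed

section \<open>Moments of the standard simplex\<close>

lemma nn_integral_FTC_Ioo:
  fixes f :: "real \<Rightarrow> real"
  assumes [measurable]: "f \<in> borel_measurable borel"
    and F: "\<And>x. DERIV F x :> f x" and f: "\<And>x. a \<le> x \<Longrightarrow> x \<le> b \<Longrightarrow> 0 \<le> f x" and ab: "a \<le> b"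
  shows "(\<integral>\<^sup>+x. ennreal (f x) * indicator {a<..<b} x \<partial>lborel) = ennreal (F b - F a)" "F a \<le> F b"
proof -
  have "(\<integral>\<^sup>+x. ennreal (f x) * indicator {a<..<b} x \<partial>lborel)
      = (\<integral>\<^sup>+x. ennreal (f x) * indicator {a..b} x \<partial>lborel)"
    using AE_lborel_singleton[of a] AE_lborel_singleton[of b]
    by (intro nn_integral_cong_AE) (auto split: split_indicator)
  also have "\<dots> = ennreal (F b - F a)"
    by (rule nn_integral_FTC_Icc) (use F f ab in auto)
  finally show "(\<integral>\<^sup>+x. ennreal (f x) * indicator {a<..<b} x \<partial>lborel) = ennreal (F b - F a)" .
  \<comment> \<open>For an iterated integral this keeps the inner value nonnegative, so that it can
    serve as the next integrand.\<close>
  show "F a \<le> F b"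
    by (rule DERIV_nonneg_imp_nondecreasing[OF ab]) (use F f in blast)
qed

text \<open>The coefficients on the right are the moments of the standard simplex: 1/2 for 1, 1/6
  for \<open>s\<close> and \<open>t\<close>, 1/12 for their squares and 1/24 for
  \<open>s * t\<close>.\<close>

lemma nn_integral_simplex_quadratic:
  fixes k0 k1 k2 k3 k4 k5 :: real
  defines "K \<equiv> \<lambda>s t. k0 + k1 * s + k2 * t + k3 * s\<^sup>2 + k4 * (s * t) + k5 * t\<^sup>2"
  assumes K: "\<And>s t. 0 \<le> K s t"
  shows "(\<integral>\<^sup>+t. \<integral>\<^sup>+s. ennreal (K s t) * indicator {(s, t). 0 < s \<and> 0 < t \<and> s + t < 1} (s, t) \<partial>lborel \<partial>lborel)
     = ennreal (k0 / 2 + (k1 + k2) / 6 + (k3 + k5) / 12 + k4 / 24)"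
    (is "?I = _")
proof -
  \<comment> \<open>\<open>F t\<close> is the antiderivative of the quadratic in \<open>s\<close>
    that vanishes at 0, and \<open>G\<close> is an antiderivative of \<open>F t (1 - t)\<close>, the
    inner integral.\<close>
  define F where "F = (\<lambda>t s. (k0 + k2 * t + k5 * t\<^sup>2) * s + (k1 + k4 * t) * s\<^sup>2 / 2 + k3 * s ^ 3 / 3)"
  define G where "G = (\<lambda>t. k0 * (t - t\<^sup>2 / 2) + k2 * (t\<^sup>2 / 2 - t ^ 3 / 3) + k5 * (t ^ 3 / 3 - t ^ 4 / 4)
     - k1 * (1 - t) ^ 3 / 6 + k4 * (t\<^sup>2 / 2 - 2 * t ^ 3 / 3 + t ^ 4 / 4) / 2 - k3 * (1 - t) ^ 4 / 12)"
  have F: "DERIV (F t) s :> K s t" for s t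
    unfolding F_def K_def
    by (auto intro!: derivative_eq_intros simp: field_simps)
  have G: "DERIV G t :> F t (1 - t)" for t
    unfolding F_def G_def
    by (auto intro!: derivative_eq_intros)
       (simp add: field_simps power2_eq_square power3_eq_cube)
  have [measurable]: "(\<lambda>s. K s t) \<in> borel_measurable borel" for t
    unfolding K_def by measurable
  have inner: "(\<integral>\<^sup>+s. ennreal (K s t) * indicator {0<..<1 - t} s \<partial>lborel) = ennreal (F t (1 - t))"
      "0 \<le> F t (1 - t)" if "t \<le> 1" for t
    using nn_integral_FTC_Ioo[of "\<lambda>s. K s t" "F t" 0 "1 - t"] that F K by (auto simp: F_def)
  have "?I = (\<integral>\<^sup>+t. ennreal (F t (1 - t)) * indicator {0<..<1} t \<partial>lborel)"
  proof (intro nn_integral_cong)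
    fix t :: real
    have "(\<integral>\<^sup>+s. ennreal (K s t) * indicator {(s, t). 0 < s \<and> 0 < t \<and> s + t < 1} (s, t) \<partial>lborel)
      = (\<integral>\<^sup>+s. ennreal (K s t) * indicator {0<..<1 - t} s * indicator {0<..<1} t \<partial>lborel)"
      by (intro nn_integral_cong) (auto split: split_indicator)
    also have "\<dots> = (\<integral>\<^sup>+s. ennreal (K s t) * indicator {0<..<1 - t} s \<partial>lborel) * indicator {0<..<1} t"
      by (rule nn_integral_multc) measurable
    also have "\<dots> = ennreal (F t (1 - t)) * indicator {0<..<1} t"
      using inner(1)[of t] by (auto split: split_indicator)
    finally show "(\<integral>\<^sup>+s. ennreal (K s t) * indicator {(s, t). 0 < s \<and> 0 < t \<and> s + t < 1} (s, t) \<partial>lborel)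
      = ennreal (F t (1 - t)) * indicator {0<..<1} t" .
  qed
  also have "\<dots> = ennreal (G 1 - G 0)"
    by (rule nn_integral_FTC_Ioo) (use G inner in \<open>auto simp: F_def\<close>)
  also have "G 1 - G 0 = k0 / 2 + (k1 + k2) / 6 + (k3 + k5) / 12 + k4 / 24"
    by (simp add: G_def field_simps)
  finally show ?thesis .
qed

subsection \<open>Integrals over triangles\<close>

lemma collinear_iff_cross:
  "collinear {a, b, c} \<longleftrightarrow> cross (b - a) (c - a) = 0"
proof -
  have "collinear {a, b, c} \<longleftrightarrow> collinear {0, b - a, c - a}"
    using collinear_3[of b a c] by (simp add: insert_commute)
  \<comment> \<open>Collinearity with 0 means that the quotient is real. If \<open>b = a\<close>,
    the quotient is 0 by convention and \<open>cross\<close> vanishes as well.\<close>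
  also have "\<dots> \<longleftrightarrow> Im ((c - a) / (b - a)) = 0"
    by (simp add: collinear_iff_Reals complex_is_Real_iff)
  also have "\<dots> \<longleftrightarrow> cross (b - a) (c - a) = 0"
    by (auto simp: cross_def Im_divide complex_eq_iff sum_power2_eq_zero_iff algebra_simps)
  finally show ?thesis .
qed

text \<open>Cramer's rule: eliminating one unknown leaves the other multiplied by the
  determinant.\<close>

lemma cross_coordinates_unique:
  assumes "cross u w \<noteq> 0" "a + s *\<^sub>R u + t *\<^sub>R w = a + s' *\<^sub>R u + t' *\<^sub>R w"
  shows "s = s'" "t = t'"
proof -
  have "(s - s') * Re u + (t - t') * Re w = 0" "(s - s') * Im u + (t - t') * Im w = 0"
    using assms(2) by (auto simp: complex_eq_iff algebra_simps)
  then have "(s - s') * cross u w = 0" "(t - t') * cross u w = 0"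
    unfolding cross_def by (simp; algebra)+
  then show "s = s'" "t = t'" using assms(1) by auto
qed

text \<open>\<open>1 - s - t\<close>, \<open>s\<close> and \<open>t\<close> are the barycentric
  coordinates at \<open>a\<close>, \<open>b\<close> and \<open>c\<close>; the interior is where all
  three are positive.\<close>

lemma in_tri_iff:
  assumes "cross (b - a) (c - a) \<noteq> 0"
  shows "a + s *\<^sub>R (b - a) + t *\<^sub>R (c - a) \<in> tri a b c \<longleftrightarrow> 0 < s \<and> 0 < t \<and> s + t < 1"
proof -
  have *: "x *\<^sub>R a + y *\<^sub>R b + z *\<^sub>R c = a + y *\<^sub>R (b - a) + z *\<^sub>R (c - a)" if "x + y + z = 1" for x y z :: real
    using that by (auto simp: complex_eq_iff) algebra+
  have "tri a b c = {v. \<exists>x y z. 0 < x \<and> 0 < y \<and> 0 < z \<and> x + y + z = 1 \<and> x *\<^sub>R a + y *\<^sub>R b + z *\<^sub>R c = v}"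
    unfolding tri_def using assms by (intro interior_convex_hull_3_minimal) (auto simp: collinear_iff_cross)
  also have "\<dots> = {v. \<exists>y z. 0 < y \<and> 0 < z \<and> y + z < 1 \<and> a + y *\<^sub>R (b - a) + z *\<^sub>R (c - a) = v}"
  proof (intro set_eqI, simp only: mem_Collect_eq, intro iffI; elim exE conjE)
    fix v :: complex and y z :: real
    assume "0 < y" "0 < z" "y + z < 1" "a + y *\<^sub>R (b - a) + z *\<^sub>R (c - a) = v"
    then show "\<exists>x y z. 0 < x \<and> 0 < y \<and> 0 < z \<and> x + y + z = 1 \<and> x *\<^sub>R a + y *\<^sub>R b + z *\<^sub>R c = v"
      by (intro exI[of _ "1 - y - z"] exI[of _ y] exI[of _ z]) (simp add: *)
  next
    fix v :: complex and x y z :: real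
    assume "0 < x" "0 < y" "0 < z" "x + y + z = 1" "x *\<^sub>R a + y *\<^sub>R b + z *\<^sub>R c = v"
    then show "\<exists>y z. 0 < y \<and> 0 < z \<and> y + z < 1 \<and> a + y *\<^sub>R (b - a) + z *\<^sub>R (c - a) = v"
      by (intro exI[of _ y] exI[of _ z]) (simp add: *)
  qed
  finally show ?thesis
    using cross_coordinates_unique[OF assms] by blast
qed

lemma borel_tri [measurable]: "tri a b c \<in> sets borel"
  by (simp add: tri_def)

text \<open>Pulled back to the standard simplex, the integrand is a quadratic in \<open>s\<close>
  and \<open>t\<close>. Its moments regroup into an expression symmetric in the three vertex
  values.\<close>

lemma nn_integral_tri_affine:
  fixes h :: "complex \<Rightarrow> complex"
  assumes [measurable]: "h \<in> borel_measurable borel" and D: "cross (b - a) (c - a) \<noteq> 0"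
    and h: "\<And>s t. h (a + s *\<^sub>R (b - a) + t *\<^sub>R (c - a)) = h a + s *\<^sub>R (h b - h a) + t *\<^sub>R (h c - h a)"
  shows "(\<integral>\<^sup>+z. ennreal ((cmod (h z))\<^sup>2) * indicator (tri a b c) z \<partial>lborel) =
    ennreal (\<bar>cross (b - a) (c - a)\<bar> / 24 *
      ((cmod (h a))\<^sup>2 + (cmod (h b))\<^sup>2 + (cmod (h c))\<^sup>2 + (cmod (h a + h b + h c))\<^sup>2))"
proof -
  define u v where "u = h b - h a" and "v = h c - h a"
  define K where "K = (\<lambda>s t. (cmod (h a))\<^sup>2 + 2 * (h a \<bullet> u) * s + 2 * (h a \<bullet> v) * t
      + (cmod u)\<^sup>2 * s\<^sup>2 + 2 * (u \<bullet> v) * (s * t) + (cmod v)\<^sup>2 * t\<^sup>2)"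
  have K: "(cmod (h a + s *\<^sub>R u + t *\<^sub>R v))\<^sup>2 = K s t" for s t
    unfolding K_def cmod_power2 by (simp add: inner_complex_def power2_eq_square algebra_simps)
  have "(\<integral>\<^sup>+z. ennreal ((cmod (h z))\<^sup>2) * indicator (tri a b c) z \<partial>lborel) =
     ennreal \<bar>cross (b - a) (c - a)\<bar> *
     (\<integral>\<^sup>+t. \<integral>\<^sup>+s. ennreal (K s t) * indicator {(s, t). 0 < s \<and> 0 < t \<and> s + t < 1} (s, t) \<partial>lborel \<partial>lborel)"
    by (subst nn_integral_complex_affine[OF _ D, of _ a], measurable)
      (simp add: h K in_tri_iff[OF D] indicator_def flip: u_def v_def)
  also have "(\<integral>\<^sup>+t. \<integral>\<^sup>+s. ennreal (K s t) * indicator {(s, t). 0 < s \<and> 0 < t \<and> s + t < 1} (s, t) \<partial>lborel \<partial>lborel)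
     = ennreal ((cmod (h a))\<^sup>2 / 2 + (2 * (h a \<bullet> u) + 2 * (h a \<bullet> v)) / 6 + ((cmod u)\<^sup>2 + (cmod v)\<^sup>2) / 12
         + 2 * (u \<bullet> v) / 24)"
    \<comment> \<open>The quadratic is nonnegative because it is a squared modulus.\<close>
    unfolding K_def by (rule nn_integral_simplex_quadratic) (simp flip: K[unfolded K_def])
  also have "(cmod (h a))\<^sup>2 / 2 + (2 * (h a \<bullet> u) + 2 * (h a \<bullet> v)) / 6 + ((cmod u)\<^sup>2 + (cmod v)\<^sup>2) / 12
         + 2 * (u \<bullet> v) / 24
     = ((cmod (h a))\<^sup>2 + (cmod (h b))\<^sup>2 + (cmod (h c))\<^sup>2 + (cmod (h a + h b + h c))\<^sup>2) / 24"
    unfolding u_def v_def cmod_power2 inner_complex_def by (simp add: power2_eq_square field_simps)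
  finally show ?thesis by (simp flip: ennreal_mult)
qed

lemma area_tri:
  assumes "cross (b - a) (c - a) \<noteq> 0"
  shows "area (tri a b c) = \<bar>cross (b - a) (c - a)\<bar> / 2"
proof -
  have "emeasure lborel (tri a b c) = (\<integral>\<^sup>+z. ennreal ((cmod 1)\<^sup>2) * indicator (tri a b c) z \<partial>lborel)"
    by simp
  also have "\<dots> = ennreal (\<bar>cross (b - a) (c - a)\<bar> / 2)"
    \<comment> \<open>For the constant 1 the bracket is 1 + 1 + 1 + 9 = 12, which turns 1/24 into
      1/2.\<close>
    using nn_integral_tri_affine[of "\<lambda>_. 1", OF _ assms] by simp
  finally show ?thesis by (simp add: measure_def)
qed

lemma set_integral_tri_affine:
  fixes h :: "complex \<Rightarrow> complex"
  assumes [measurable]: "h \<in> borel_measurable borel" and D: "cross (b - a) (c - a) \<noteq> 0"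
    and h: "\<And>s t. h (a + s *\<^sub>R (b - a) + t *\<^sub>R (c - a)) = h a + s *\<^sub>R (h b - h a) + t *\<^sub>R (h c - h a)"
  shows "(LINT z:tri a b c|lborel. (cmod (h z))\<^sup>2) =
    \<bar>cross (b - a) (c - a)\<bar> / 24 *
      ((cmod (h a))\<^sup>2 + (cmod (h b))\<^sup>2 + (cmod (h c))\<^sup>2 + (cmod (h a + h b + h c))\<^sup>2)"
proof -
  have "(LINT z:tri a b c|lborel. (cmod (h z))\<^sup>2) =
     enn2real (\<integral>\<^sup>+z. ennreal (indicator (tri a b c) z *\<^sub>R (cmod (h z))\<^sup>2) \<partial>lborel)"
    unfolding set_lebesgue_integral_def by (rule integral_eq_nn_integral) auto
  also have "(\<integral>\<^sup>+z. ennreal (indicator (tri a b c) z *\<^sub>R (cmod (h z))\<^sup>2) \<partial>lborel)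
     = (\<integral>\<^sup>+z. ennreal ((cmod (h z))\<^sup>2) * indicator (tri a b c) z \<partial>lborel)"
    by (intro nn_integral_cong) (auto split: split_indicator)
  finally show ?thesis
    unfolding nn_integral_tri_affine[OF assms] by simp
qed

section \<open>The value of \<open>rho 1\<close> on a triangle\<close>

definition side_sum :: "complex \<Rightarrow> complex \<Rightarrow> complex \<Rightarrow> real" where
  "side_sum a b c = (dist a b)\<^sup>2 + (dist b c)\<^sup>2 + (dist c a)\<^sup>2"

text \<open>Here \<open>x\<close>, \<open>y\<close>, \<open>z\<close> are the vertices relative to
  the centroid and \<open>m\<close> is the value of the affine map at the centroid. Terms linear in
  \<open>m\<close> cancel because \<open>x + y + z = 0\<close>, and the square is completed in
  \<open>\<beta>\<close>. The factor \<open>P\<close> avoids division.\<close>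

lemma affine_defect:
  fixes x y z m \<beta> :: complex
  defines "P \<equiv> (cmod x)\<^sup>2 + (cmod y)\<^sup>2 + (cmod z)\<^sup>2" and "Q \<equiv> x\<^sup>2 + y\<^sup>2 + z\<^sup>2"
  assumes 0: "x + y + z = 0"
  shows "P * ((cmod (m + cnj x - \<beta> * x))\<^sup>2 + (cmod (m + cnj y - \<beta> * y))\<^sup>2 + (cmod (m + cnj z - \<beta> * z))\<^sup>2
      + (cmod (3 * m))\<^sup>2)
    = P * (12 * (cmod m)\<^sup>2) + (cmod (P * \<beta> - cnj Q))\<^sup>2 + 12 * (cross x y)\<^sup>2"
proof -
  have z: "z = - x - y" using 0 by (simp add: add_eq_0_iff algebra_simps)
  have 1: "(cmod (m + cnj x - \<beta> * x))\<^sup>2 + (cmod (m + cnj y - \<beta> * y))\<^sup>2 + (cmod (m + cnj z - \<beta> * z))\<^sup>2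
      + (cmod (3 * m))\<^sup>2 = 12 * (cmod m)\<^sup>2 + P * (1 + (cmod \<beta>)\<^sup>2) - 2 * Re (\<beta> * Q)"
    unfolding P_def Q_def z cmod_power2 by (simp add: power2_eq_square algebra_simps)
  have 2: "(cmod (P * \<beta> - cnj Q))\<^sup>2 = P\<^sup>2 * (cmod \<beta>)\<^sup>2 - P * (2 * Re (\<beta> * Q)) + (cmod Q)\<^sup>2"
    unfolding cmod_power2 by (simp add: power2_eq_square algebra_simps)
  \<comment> \<open>Each pair of vertices contributes four times its squared \<open>cross\<close>,
    and the three pairs have equal \<open>cross\<close> up to sign.\<close>
  have 3: "P\<^sup>2 - (cmod Q)\<^sup>2 = 12 * (cross x y)\<^sup>2"
    unfolding P_def Q_def z cross_def cmod_power2 by (simp add: power2_eq_square algebra_simps)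
  show ?thesis unfolding 1 2 3[symmetric] by (simp add: power2_eq_square algebra_simps)
qed

lemma degree_le_1_iff: "degree p \<le> 1 \<longleftrightarrow> (\<exists>\<alpha> \<beta>. p = [:\<alpha>, \<beta>:])"
proof
  assume "degree p \<le> 1"
  then have "p = [:coeff p 0, coeff p 1:]"
    by (intro poly_eqI) (auto simp: coeff_pCons coeff_eq_0 split: nat.split)
  then show "\<exists>\<alpha> \<beta>. p = [:\<alpha>, \<beta>:]" by blast
qed auto

text \<open>The integral is the claimed value plus two nonnegative terms, and a suitable choice of
  \<open>\<alpha>\<close> and \<open>\<beta>\<close> makes both vanish. Hence the infimum is
  attained.\<close>

lemma rho_tri:
  assumes D: "cross (b - a) (c - a) \<noteq> 0"
  shows "rho 1 (tri a b c) = \<bar>cross (b - a) (c - a)\<bar> ^ 3 / (6 * side_sum a b c)"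
proof -
  define g where "g = (a + b + c) / 3"
  define x y z where "x = a - g" and "y = b - g" and "z = c - g"
  have xyz: "x + y + z = 0" by (simp add: x_def y_def z_def g_def field_simps)
  define P where "P = (cmod x)\<^sup>2 + (cmod y)\<^sup>2 + (cmod z)\<^sup>2"
  define Q where "Q = x\<^sup>2 + y\<^sup>2 + z\<^sup>2"
  have z: "z = - x - y" using xyz by (simp add: add_eq_0_iff algebra_simps)
  have abc: "b - a = y - x" "c - a = z - x" "c - b = z - y" by (simp_all add: x_def y_def z_def)
  have S: "side_sum a b c = 3 * P"
    unfolding side_sum_def P_def dist_norm norm_minus_commute[of a b] norm_minus_commute[of b c] abc z cmod_power2
    by (simp add: power2_eq_square algebra_simps)
  have Dxy: "cross (b - a) (c - a) = 3 * cross x y"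
    unfolding abc z cross_def by (simp add: algebra_simps)
  have "x \<noteq> 0" using D Dxy by (auto simp: cross_def)
  then have P: "P > 0" unfolding P_def by (simp add: add_pos_nonneg)
  define I where "I = (\<lambda>p. LINT z:tri a b c|lborel. (cmod (cnj z - poly p z))\<^sup>2)"
  have I: "I [:\<alpha>, \<beta>:] = \<bar>cross (b - a) (c - a)\<bar> / 24 *
      (12 * (cmod (cnj g - \<alpha> - \<beta> * g))\<^sup>2 + (cmod (P * \<beta> - cnj Q))\<^sup>2 / P) +
      \<bar>cross (b - a) (c - a)\<bar> ^ 3 / (6 * side_sum a b c)" for \<alpha> \<beta> :: complex
  proof -
    define m where "m = cnj g - \<alpha> - \<beta> * g"
    define h where "h = (\<lambda>w. cnj w - poly [:\<alpha>, \<beta>:] w)"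
    define E where "E = (cmod (h a))\<^sup>2 + (cmod (h b))\<^sup>2 + (cmod (h c))\<^sup>2 + (cmod (h a + h b + h c))\<^sup>2"
    have ha: "h a = m + cnj x - \<beta> * x" "h b = m + cnj y - \<beta> * y" "h c = m + cnj z - \<beta> * z"
      by (simp_all add: h_def m_def x_def y_def z_def algebra_simps)
    have hs: "h a + h b + h c = 3 * m"
      unfolding ha z by (simp add: algebra_simps)
    have hm: "h \<in> borel_measurable borel"
      unfolding h_def by (intro borel_measurable_continuous_onI continuous_intros)
    have hl: "h (a + s *\<^sub>R (b - a) + t *\<^sub>R (c - a)) = h a + s *\<^sub>R (h b - h a) + t *\<^sub>R (h c - h a)" for s t
      by (simp add: h_def scaleR_conv_of_real algebra_simps)
    have I_E: "I [:\<alpha>, \<beta>:] = \<bar>cross (b - a) (c - a)\<bar> / 24 * E"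
      using set_integral_tri_affine[OF hm D hl] unfolding I_def E_def by (simp only: h_def)
    have "P * E = P * (12 * (cmod m)\<^sup>2) + (cmod (P * \<beta> - cnj Q))\<^sup>2 + 12 * (cross x y)\<^sup>2"
      unfolding E_def hs unfolding ha P_def Q_def by (rule affine_defect[OF xyz])
    then have "E = 12 * (cmod m)\<^sup>2 + (cmod (P * \<beta> - cnj Q))\<^sup>2 / P + 12 * (cross x y)\<^sup>2 / P"
      using P by (simp add: field_simps)
    \<comment> \<open>The constant comes from \<open>cross x y\<close> being a third of the full
      determinant and \<open>side_sum\<close> being \<open>3 * P\<close>.\<close>
    moreover have "\<bar>cross (b - a) (c - a)\<bar> / 24 * (12 * (cross x y)\<^sup>2 / P) =
        \<bar>cross (b - a) (c - a)\<bar> ^ 3 / (6 * side_sum a b c)"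
    proof -
      have "\<bar>cross (b - a) (c - a)\<bar> ^ 3 = \<bar>cross (b - a) (c - a)\<bar> * (9 * (cross x y)\<^sup>2)"
        unfolding Dxy by (simp add: power3_eq_cube power2_eq_square)
      then show ?thesis unfolding S using P by (simp add: field_simps)
    qed
    ultimately show ?thesis
      unfolding I_E m_def[symmetric] by (simp only: ring_distribs)
  qed
  have rho: "rho 1 (tri a b c) = (INF p\<in>{p. degree p \<le> 1}. I p)"
    by (simp add: rho_def I_def)
  have nonneg: "0 \<le> \<bar>cross (b - a) (c - a)\<bar> / 24 *
      (12 * (cmod (cnj g - \<alpha> - \<beta> * g))\<^sup>2 + (cmod (P * \<beta> - cnj Q))\<^sup>2 / P)" for \<alpha> \<beta> :: complex
    using P by (intro mult_nonneg_nonneg add_nonneg_nonneg) auto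
  have ge: "\<bar>cross (b - a) (c - a)\<bar> ^ 3 / (6 * side_sum a b c) \<le> I p" if "degree p \<le> 1" for p
    using that nonneg unfolding degree_le_1_iff by (auto simp: I)
  \<comment> \<open>This slope kills the second square; the constant term
    \<open>cnj g - \<beta> * g\<close> then makes the polynomial agree with \<open>cnj\<close> at
    the centroid and kills the first.\<close>
  define \<beta> where "\<beta> = cnj Q / P"
  have opt: "I [:cnj g - \<beta> * g, \<beta>:] = \<bar>cross (b - a) (c - a)\<bar> ^ 3 / (6 * side_sum a b c)"
    using P unfolding I by (simp add: \<beta>_def)
  show ?thesis unfolding rho
  proof (rule antisym)
    show "(INF p\<in>{p. degree p \<le> 1}. I p) \<le> \<bar>cross (b - a) (c - a)\<bar> ^ 3 / (6 * side_sum a b c)"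
      unfolding opt[symmetric]
      by (rule cINF_lower) (use ge in \<open>auto simp: degree_le_1_iff intro!: bdd_belowI2\<close>)
    show "\<bar>cross (b - a) (c - a)\<bar> ^ 3 / (6 * side_sum a b c) \<le> (INF p\<in>{p. degree p \<le> 1}. I p)"
      by (rule cINF_greatest) (use ge in \<open>auto intro: exI[of _ 0]\<close>)
  qed
qed

subsection \<open>Side lengths and congruence\<close>

text \<open>Heron's formula in squared side lengths; both sides are 16 times the squared
  area.\<close>

lemma heron_cross:
  fixes a b c :: complex
  defines "x \<equiv> (dist a b)\<^sup>2" and "y \<equiv> (dist b c)\<^sup>2" and "z \<equiv> (dist c a)\<^sup>2"
  shows "4 * (cross (b - a) (c - a))\<^sup>2 = 2 * (x * y + y * z + z * x) - (x\<^sup>2 + y\<^sup>2 + z\<^sup>2)"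
  unfolding x_def y_def z_def dist_norm cmod_power2 cross_def
  by (simp add: power2_eq_square algebra_simps)

text \<open>By Heron's formula the side lengths determine the area. The squares are needed since a
  reflection reverses the sign of \<open>cross\<close>.\<close>

lemma cross_square_cong:
  assumes "dist a b = dist a' b'" "dist b c = dist b' c'" "dist c a = dist c' a'"
  shows "(cross (b - a) (c - a))\<^sup>2 = (cross (b' - a') (c' - a'))\<^sup>2"
  using heron_cross[of b a c] heron_cross[of b' a' c'] unfolding assms by linarith

lemma side_sum_square:
  fixes a b c :: complex
  defines "x \<equiv> (dist a b)\<^sup>2" and "y \<equiv> (dist b c)\<^sup>2" and "z \<equiv> (dist c a)\<^sup>2"
  shows "(side_sum a b c)\<^sup>2 =
    12 * (cross (b - a) (c - a))\<^sup>2 + 2 * ((x - y)\<^sup>2 + (y - z)\<^sup>2 + (z - x)\<^sup>2)"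
  using heron_cross[of b a c] unfolding side_sum_def x_def[symmetric] y_def[symmetric] z_def[symmetric]
  by (simp add: power2_eq_square algebra_simps)

lemma side_sum_nonneg: "0 \<le> side_sum a b c"
  by (simp add: side_sum_def)

lemma side_sum_pos:
  assumes "cross (b - a) (c - a) \<noteq> 0"
  shows "0 < side_sum a b c"
proof -
  have "0 < (side_sum a b c)\<^sup>2"
    unfolding side_sum_square using assms by (intro add_pos_nonneg) auto
  then show ?thesis using side_sum_nonneg[of a b c] by (cases "side_sum a b c = 0") auto
qed

text \<open>Weitzenboeck's inequality: the sum of the squared sides is at least
  \<open>4 * sqrt 3\<close> times the area.\<close>

lemma side_sum_ge: "sqrt 12 * \<bar>cross (b - a) (c - a)\<bar> \<le> side_sum a b c"
  by (rule power2_le_imp_le[OF _ side_sum_nonneg])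
    (simp add: side_sum_square power_mult_distrib)

lemma side_sum_eq_iff:
  "side_sum a b c = sqrt 12 * \<bar>cross (b - a) (c - a)\<bar> \<longleftrightarrow> dist a b = dist b c \<and> dist b c = dist c a"
proof -
  have "side_sum a b c = sqrt 12 * \<bar>cross (b - a) (c - a)\<bar> \<longleftrightarrow>
      (side_sum a b c)\<^sup>2 = (sqrt 12 * \<bar>cross (b - a) (c - a)\<bar>)\<^sup>2"
    by (rule power2_eq_iff_nonneg[symmetric]) (auto simp: side_sum_nonneg)
  also have "\<dots> \<longleftrightarrow> (dist a b)\<^sup>2 = (dist b c)\<^sup>2 \<and> (dist b c)\<^sup>2 = (dist c a)\<^sup>2"
    by (auto simp: side_sum_square power_mult_distrib add_nonneg_eq_0_iff)
  finally show ?thesis by simp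
qed

text \<open>An isometry of the plane is an injective linear map followed by a translation, and both
  commute with convex hulls and interiors.\<close>

lemma isometry_image_tri:
  fixes f :: "complex \<Rightarrow> complex"
  assumes f: "\<And>x y. dist (f x) (f y) = dist x y"
  shows "f ` tri a b c = tri (f a) (f b) (f c)"
proof -
  define g where "g = (\<lambda>x. f x - f 0)"
  have d: "dist (g x) (g y) = dist x y" for x y using f[of x y] by (simp add: g_def dist_norm)
  have lin: "linear g" by (rule isometry_linear) (auto simp: d, simp add: g_def)
  have inj: "inj g" by (metis d dist_eq_0_iff injI)
  have im: "f ` S = (+) (f 0) ` g ` S" for S by (auto simp: g_def image_image)
  show ?thesis
    unfolding tri_def im interior_injective_linear_image[OF lin inj, symmetric]
      convex_hull_linear_image[OF lin] interior_translation[symmetric] convex_hull_translation[symmetric]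
    by (simp add: g_def)
qed

text \<open>The real part of \<open>cnj u * w\<close> is the inner product, its imaginary part is
  \<open>cross u w\<close>. The side lengths fix the real part and the modulus, hence the imaginary
  part up to sign; one sign yields a rotation, the other a reflection.\<close>

lemma isometry_between_triangles:
  fixes a b c a' b' c' :: complex
  assumes d: "dist a b = dist a' b'" "dist b c = dist b' c'" "dist c a = dist c' a'" and ab: "a \<noteq> b"
  obtains f :: "complex \<Rightarrow> complex"
    where "\<And>x y. dist (f x) (f y) = dist x y" "f a = a'" "f b = b'" "f c = c'"
proof -
  define u w u' w' where "u = b - a" and "w = c - a" and "u' = b' - a'" and "w' = c' - a'"
  have n: "cmod u = cmod u'" "cmod w = cmod w'" "cmod (u - w) = cmod (u' - w')"
    using d by (simp_all add: u_def w_def u'_def w'_def dist_norm norm_minus_commute)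
  have u: "u \<noteq> 0" "u' \<noteq> 0" using ab d(1) by (auto simp: u_def u'_def)
  define \<alpha> where "\<alpha> = u' / u"
  have \<alpha>: "cmod \<alpha> = 1" using n u by (simp add: \<alpha>_def norm_divide)
  have "(cmod u)\<^sup>2 = (cmod u')\<^sup>2" "(cmod w)\<^sup>2 = (cmod w')\<^sup>2" "(cmod (u - w))\<^sup>2 = (cmod (u' - w'))\<^sup>2"
    using n by simp_all
  then have re: "Re (cnj u * w) = Re (cnj u' * w')"
    unfolding cmod_power2 by (simp add: power2_eq_square algebra_simps)
  have "(cmod (cnj u * w))\<^sup>2 = (cmod (cnj u' * w'))\<^sup>2"
    using n by (simp add: norm_mult)
  then have "(Im (cnj u * w))\<^sup>2 = (Im (cnj u' * w'))\<^sup>2"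
    unfolding cmod_power2 re by simp
  then consider "Im (cnj u' * w') = Im (cnj u * w)" | "Im (cnj u' * w') = - Im (cnj u * w)"
    by (metis power2_eq_iff minus_minus)
  then consider "cnj u' * w' = cnj u * w" | "cnj u' * w' = cnj (cnj u * w)"
    using re by cases (auto simp: complex_eq_iff)
  then show ?thesis
  proof cases
    case 1
    have "w' * (cnj u' * u') = (cnj u' * w') * u'" by simp
    also have "\<dots> = cnj u * u * (\<alpha> * w)" unfolding 1 using u by (simp add: \<alpha>_def)
    also have "cnj u * u = cnj u' * u'"
      using n by (metis complex_norm_square mult.commute)
    finally have w': "w' = \<alpha> * w" using u by simp
    show ?thesis
    proof (rule that[of "\<lambda>z. a' + \<alpha> * (z - a)"])
      show "dist (a' + \<alpha> * (x - a)) (a' + \<alpha> * (y - a)) = dist x y" for x y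
        using \<alpha> by (simp add: dist_norm norm_mult flip: right_diff_distrib)
      show "a' + \<alpha> * (b - a) = b'" using u by (simp add: \<alpha>_def u'_def flip: u_def)
      show "a' + \<alpha> * (c - a) = c'" using w' by (simp add: w'_def w_def algebra_simps)
    qed simp
  next
    case 2
    define \<gamma> where "\<gamma> = u' / cnj u"
    have \<gamma>: "cmod \<gamma> = 1" using n u by (simp add: \<gamma>_def norm_divide)
    have "w' * (cnj u' * u') = (cnj u' * w') * u'" by simp
    also have "\<dots> = cnj u * u * (\<gamma> * cnj w)" unfolding 2 using u by (simp add: \<gamma>_def)
    also have "cnj u * u = cnj u' * u'"
      using n by (metis complex_norm_square mult.commute)
    finally have w': "w' = \<gamma> * cnj w" using u by simp
    show ?thesis
    proof (rule that[of "\<lambda>z. a' + \<gamma> * cnj (z - a)"])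
      show "dist (a' + \<gamma> * cnj (x - a)) (a' + \<gamma> * cnj (y - a)) = dist x y" for x y
      proof -
        have "dist (a' + \<gamma> * cnj (x - a)) (a' + \<gamma> * cnj (y - a)) = cmod (\<gamma> * cnj (x - y))"
          by (simp add: dist_norm algebra_simps)
        then show ?thesis using \<gamma> by (simp only: norm_mult complex_mod_cnj dist_norm mult_1)
      qed
      show "a' + \<gamma> * cnj (b - a) = b'" using u by (simp add: \<gamma>_def u'_def flip: u_def)
      show "a' + \<gamma> * cnj (c - a) = c'" using w' by (simp add: w'_def w_def algebra_simps)
    qed simp
  qed
qed

lemma congruent_sets_tri:
  assumes "dist a b = dist a' b'" "dist b c = dist b' c'" "dist c a = dist c' a'" "a \<noteq> b"
  shows "congruent_sets (tri a b c) (tri a' b' c')"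
  using isometry_between_triangles[OF assms] isometry_image_tri
  unfolding congruent_sets_def by metis

subsection \<open>Steiner symmetrization\<close>

text \<open>\<open>\<zeta>\<close> is the relative height above the side \<open>ab\<close>: it is \<open>0\<close> on this side and \<open>1\<close> at \<open>c\<close>.\<close>

lemma in_tri_coordinates_iff:
  fixes q v n :: complex and sa sc ta tb tc :: real
  defines "a \<equiv> q + sa *\<^sub>R v + ta *\<^sub>R n" and "b \<equiv> q + sa *\<^sub>R v + tb *\<^sub>R n" and "c \<equiv> q + sc *\<^sub>R v + tc *\<^sub>R n"
  assumes D: "cross (b - a) (c - a) \<noteq> 0" and ne: "sa \<noteq> sc" "ta \<noteq> tb"
  defines "\<zeta> \<equiv> \<lambda>s. (s - sa) / (sc - sa)"
  shows "q + s *\<^sub>R v + \<tau> *\<^sub>R n \<in> tri a b c \<longleftrightarrow>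
    0 < \<zeta> s \<and> \<zeta> s < 1 \<and> \<bar>\<tau> - ((1 - \<zeta> s) * (ta + tb) / 2 + \<zeta> s * tc)\<bar> < (1 - \<zeta> s) * \<bar>tb - ta\<bar> / 2"
proof -
  define y where "y = (\<tau> - ta - \<zeta> s * (tc - ta)) / (tb - ta)"
  have s: "s = sa + \<zeta> s * (sc - sa)" using ne by (simp add: \<zeta>_def)
  have \<tau>: "\<tau> = ta + y * (tb - ta) + \<zeta> s * (tc - ta)" using ne by (simp add: y_def)
  have "q + s *\<^sub>R v + \<tau> *\<^sub>R n = a + y *\<^sub>R (b - a) + \<zeta> s *\<^sub>R (c - a)"
    unfolding a_def b_def c_def by (subst s, subst \<tau>) (simp add: algebra_simps)
  then have "q + s *\<^sub>R v + \<tau> *\<^sub>R n \<in> tri a b c \<longleftrightarrow> 0 < y \<and> 0 < \<zeta> s \<and> y + \<zeta> s < 1"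
    using in_tri_iff[OF D] by simp
  also have "\<dots> \<longleftrightarrow> 0 < \<zeta> s \<and> \<zeta> s < 1 \<and> \<bar>y - (1 - \<zeta> s) / 2\<bar> < (1 - \<zeta> s) / 2"
    by (auto simp: abs_less_iff field_simps)
  also have "\<bar>y - (1 - \<zeta> s) / 2\<bar> < (1 - \<zeta> s) / 2 \<longleftrightarrow>
      \<bar>tb - ta\<bar> * \<bar>y - (1 - \<zeta> s) / 2\<bar> < \<bar>tb - ta\<bar> * ((1 - \<zeta> s) / 2)"
    using ne by (intro mult_less_cancel_left_pos[symmetric]) auto
  also have "\<bar>tb - ta\<bar> * \<bar>y - (1 - \<zeta> s) / 2\<bar> = \<bar>\<tau> - ((1 - \<zeta> s) * (ta + tb) / 2 + \<zeta> s * tc)\<bar>"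
    unfolding abs_mult[symmetric] by (subst \<tau>) (simp add: field_simps)
  finally show ?thesis by (simp add: mult.commute)
qed

text \<open>The coordinates are the real and imaginary parts of \<open>(z - q) / v\<close>, the
  latter rescaled by \<open>cmod v\<close> because the normal has unit length.\<close>

lemma frame_coordinates:
  fixes v :: complex
  assumes "v \<noteq> 0"
  obtains s t where "z = q + s *\<^sub>R v + t *\<^sub>R (\<i> * sgn v)"
proof -
  have "z - q = ((z - q) / v) * v" using assms by simp
  also have "\<dots> = (Re ((z - q) / v) + \<i> * Im ((z - q) / v)) * v" by (simp flip: complex_eq)
  finally have "z = q + Re ((z - q) / v) *\<^sub>R v + (Im ((z - q) / v) * cmod v) *\<^sub>R (\<i> * sgn v)"
    using assms by (simp add: sgn_eq scaleR_conv_of_real algebra_simps)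
  then show ?thesis by (rule that)
qed

text \<open>The side \<open>ab\<close> is perpendicular to the axis, so the slice at relative height
  \<open>\<zeta>\<close> is an interval of length
  \<open>(1 - \<zeta>) * \<bar>tb - ta\<bar>\<close>. Centering all slices centers the base and
  moves the apex onto the axis.\<close>

lemma steiner_tri:
  fixes q v :: complex and sa sc ta tb tc :: real
  defines "n \<equiv> \<i> * sgn v"
  defines "a \<equiv> q + sa *\<^sub>R v + ta *\<^sub>R n" and "b \<equiv> q + sa *\<^sub>R v + tb *\<^sub>R n" and "c \<equiv> q + sc *\<^sub>R v + tc *\<^sub>R n"
  defines "a' \<equiv> q + sa *\<^sub>R v + (- (tb - ta) / 2) *\<^sub>R n" and "b' \<equiv> q + sa *\<^sub>R v + ((tb - ta) / 2) *\<^sub>R n"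
    and "c' \<equiv> q + sc *\<^sub>R v + 0 *\<^sub>R n"
  assumes D: "cross (b - a) (c - a) \<noteq> 0"
  shows "cross (b' - a') (c' - a') = cross (b - a) (c - a)" "steiner q v (tri a b c) = tri a' b' c'"
proof -
  have "cross n v = - ((cmod v)\<^sup>2 / cmod v)"
    unfolding cmod_power2
    by (simp add: n_def cross_def sgn_div_norm divide_inverse power2_eq_square algebra_simps)
  then have vn: "cross n v = - cmod v" by (simp add: power2_eq_square)
  have D1: "cross (b - a) (c - a) = (tb - ta) * (sc - sa) * cross n v"
    unfolding a_def b_def c_def cross_def by (simp add: algebra_simps)
  have D2: "cross (b' - a') (c' - a') = (tb - ta) * (sc - sa) * cross n v"
    unfolding a'_def b'_def c'_def cross_def by (simp add: field_simps)
  show D': "cross (b' - a') (c' - a') = cross (b - a) (c - a)" using D1 D2 by simp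
  have ne: "sa \<noteq> sc" "ta \<noteq> tb" "v \<noteq> 0" using D unfolding D1 vn by auto
  define \<zeta> where "\<zeta> = (\<lambda>s. (s - sa) / (sc - sa))"
  have T: "q + s *\<^sub>R v + \<tau> *\<^sub>R n \<in> tri a b c \<longleftrightarrow>
    0 < \<zeta> s \<and> \<zeta> s < 1 \<and> \<bar>\<tau> - ((1 - \<zeta> s) * (ta + tb) / 2 + \<zeta> s * tc)\<bar> < (1 - \<zeta> s) * \<bar>tb - ta\<bar> / 2" for s \<tau>
    using in_tri_coordinates_iff[OF D[unfolded a_def b_def c_def] ne(1,2)]
    unfolding a_def b_def c_def \<zeta>_def by blast
  have T': "q + s *\<^sub>R v + \<tau> *\<^sub>R n \<in> tri a' b' c' \<longleftrightarrow>
    0 < \<zeta> s \<and> \<zeta> s < 1 \<and> \<bar>\<tau>\<bar> < (1 - \<zeta> s) * \<bar>tb - ta\<bar> / 2" for s \<tau>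
  proof -
    have eqs: "- (tb - ta) / 2 \<noteq> (tb - ta) / 2" "- (tb - ta) / 2 + (tb - ta) / 2 = 0"
      "(tb - ta) / 2 - - (tb - ta) / 2 = tb - ta"
      using ne(2) by (auto simp: field_simps)
    show ?thesis
      using in_tri_coordinates_iff[OF D[folded D', unfolded a'_def b'_def c'_def] ne(1) eqs(1), of s \<tau>]
      unfolding a'_def b'_def c'_def \<zeta>_def eqs by simp
  qed
  have slice: "(\<exists>\<tau>. q + s *\<^sub>R v + \<tau> *\<^sub>R n \<in> tri a b c) \<and>
      \<bar>t\<bar> < measure lborel {\<tau>. q + s *\<^sub>R v + \<tau> *\<^sub>R n \<in> tri a b c} / 2 \<longleftrightarrow>
      q + s *\<^sub>R v + t *\<^sub>R n \<in> tri a' b' c'" for s t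
  proof (cases "0 < \<zeta> s \<and> \<zeta> s < 1")
    case True
    \<comment> \<open>Midpoint and half-length of the slice.\<close>
    define m r where "m = (1 - \<zeta> s) * (ta + tb) / 2 + \<zeta> s * tc" and "r = (1 - \<zeta> s) * \<bar>tb - ta\<bar> / 2"
    have r: "r > 0" using True ne by (simp add: r_def)
    have "{\<tau>. q + s *\<^sub>R v + \<tau> *\<^sub>R n \<in> tri a b c} = {m - r<..<m + r}"
      using True unfolding T m_def[symmetric] r_def[symmetric] by auto
    moreover have "q + s *\<^sub>R v + m *\<^sub>R n \<in> tri a b c"
      using True r unfolding T m_def[symmetric] r_def[symmetric] by simp
    ultimately show ?thesis
      using True r unfolding T' r_def[symmetric] by auto
  qed (auto simp: T T')
  show "steiner q v (tri a b c) = tri a' b' c'"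
  proof (rule set_eqI)
    fix z
    obtain s t where z: "z = q + s *\<^sub>R v + t *\<^sub>R n"
      unfolding n_def by (rule frame_coordinates[OF ne(3)])
    show "z \<in> steiner q v (tri a b c) \<longleftrightarrow> z \<in> tri a' b' c'"
      unfolding steiner_def n_def[symmetric] slice mem_Collect_eq using z by metis
  qed
qed

lemma dist_frame:
  fixes q v :: complex
  defines "n \<equiv> \<i> * sgn v"
  assumes "v \<noteq> 0"
  shows "(dist (q + s *\<^sub>R v + t *\<^sub>R n) (q + s' *\<^sub>R v + t' *\<^sub>R n))\<^sup>2 = (s - s')\<^sup>2 * (cmod v)\<^sup>2 + (t - t')\<^sup>2"
proof -
  have "cmod n = 1" "v \<bullet> n = 0"
    using assms by (simp_all add: n_def norm_mult norm_sgn sgn_div_norm inner_complex_def)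
  then have "n \<bullet> n = 1" "v \<bullet> n = 0" "n \<bullet> v = 0"
    by (simp_all add: inner_commute[of n v] norm_eq_1)
  moreover have "q + s *\<^sub>R v + t *\<^sub>R n - (q + s' *\<^sub>R v + t' *\<^sub>R n) = (s - s') *\<^sub>R v + (t - t') *\<^sub>R n"
    by (simp add: algebra_simps)
  ultimately show ?thesis
    unfolding dist_norm power2_norm_eq_inner
    by (simp only: inner_add_left inner_add_right inner_scaleR_left inner_scaleR_right)
      (simp add: power2_eq_square)
qed

text \<open>If d is the distance along the base from its midpoint to the foot of the altitude from
  \<open>c\<close>, the two other squared sides lose 2 d^2 in total, while their difference is 2 d
  times the base up to sign. Eliminating d gives the last identity.\<close>

lemma steiner_triangle:
  assumes D: "cross (b - a) (c - a) \<noteq> 0" and v: "v \<noteq> 0" "v \<bullet> (b - a) = 0"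
  obtains a' b' c' where "steiner q v (tri a b c) = tri a' b' c'"
    "cross (b' - a') (c' - a') = cross (b - a) (c - a)"
    "dist a' b' = dist a b" "dist b' c' = dist c' a'"
    "(dist b c)\<^sup>2 + (dist c a)\<^sup>2 - ((dist b' c')\<^sup>2 + (dist c' a')\<^sup>2)
       = ((dist c a)\<^sup>2 - (dist c b)\<^sup>2)\<^sup>2 / (2 * (dist a b)\<^sup>2)"
proof -
  define n where "n = \<i> * sgn v"
  obtain sa ta where a: "a = q + sa *\<^sub>R v + ta *\<^sub>R n"
    unfolding n_def by (rule frame_coordinates[OF v(1)])
  obtain sb tb where b: "b = q + sb *\<^sub>R v + tb *\<^sub>R n"
    unfolding n_def by (rule frame_coordinates[OF v(1)])
  obtain sc tc where c: "c = q + sc *\<^sub>R v + tc *\<^sub>R n"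
    unfolding n_def by (rule frame_coordinates[OF v(1)])
  have "v \<bullet> n = 0" by (simp add: n_def sgn_div_norm inner_complex_def)
  moreover have "b - a = (sb - sa) *\<^sub>R v + (tb - ta) *\<^sub>R n"
    unfolding a b by (simp add: algebra_simps)
  \<comment> \<open>Orthogonality of \<open>v\<close> to the base gives \<open>a\<close> and
    \<open>b\<close> the same coordinate along the axis.\<close>
  ultimately have "(sb - sa) * (v \<bullet> v) = 0" using v(2) by (simp add: inner_add_right)
  then have sb: "sb = sa" using v(1) by simp
  note coords = a b[unfolded sb] c
  have "ta \<noteq> tb" using D coords by (auto simp: cross_def)
  define a' b' c' where "a' = q + sa *\<^sub>R v + (- (tb - ta) / 2) *\<^sub>R n"
    and "b' = q + sa *\<^sub>R v + ((tb - ta) / 2) *\<^sub>R n" and "c' = q + sc *\<^sub>R v + 0 *\<^sub>R n"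
  note st = steiner_tri[OF D[unfolded coords n_def], folded n_def, folded coords, folded a'_def b'_def c'_def]
  note dist = dist_frame[OF v(1), of q, folded n_def]
  have dist_eqI: "dist x y = dist x' y'" if "(dist x y)\<^sup>2 = (dist x' y')\<^sup>2" for x y x' y' :: complex
    using that by simp
  show ?thesis
  proof (rule that[OF st(2,1)])
    show "dist a' b' = dist a b"
      by (rule dist_eqI) (unfold coords a'_def b'_def dist, simp add: power2_eq_square algebra_simps)
    show "dist b' c' = dist c' a'"
      by (rule dist_eqI) (unfold c'_def a'_def b'_def dist, simp add: power2_eq_square algebra_simps)
    show "(dist b c)\<^sup>2 + (dist c a)\<^sup>2 - ((dist b' c')\<^sup>2 + (dist c' a')\<^sup>2)
       = ((dist c a)\<^sup>2 - (dist c b)\<^sup>2)\<^sup>2 / (2 * (dist a b)\<^sup>2)"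
      unfolding c'_def a'_def b'_def coords dist using \<open>ta \<noteq> tb\<close>
      by (simp add: divide_simps) (simp add: power2_eq_square algebra_simps)
  qed
qed

text \<open>The determinant is preserved, so only \<open>side_sum\<close> matters. It drops by a
  square that vanishes exactly when \<open>c\<close> is equidistant from \<open>a\<close> and
  \<open>b\<close>; in that case all side lengths are kept.\<close>

lemma rho_steiner_triangle:
  assumes D: "cross (b - a) (c - a) \<noteq> 0" and v: "v \<noteq> 0" "v \<bullet> (b - a) = 0"
  shows "dist c a \<noteq> dist c b \<Longrightarrow> rho 1 (tri a b c) < rho 1 (steiner q v (tri a b c))"
    and "dist c a = dist c b \<Longrightarrow> congruent_sets (steiner q v (tri a b c)) (tri a b c)"
proof -
  obtain a' b' c' where st: "steiner q v (tri a b c) = tri a' b' c'"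
    and D': "cross (b' - a') (c' - a') = cross (b - a) (c - a)"
    and d: "dist a' b' = dist a b" "dist b' c' = dist c' a'"
    and diff: "(dist b c)\<^sup>2 + (dist c a)\<^sup>2 - ((dist b' c')\<^sup>2 + (dist c' a')\<^sup>2)
       = ((dist c a)\<^sup>2 - (dist c b)\<^sup>2)\<^sup>2 / (2 * (dist a b)\<^sup>2)"
    using steiner_triangle[OF assms] .
  have D0: "cross (b' - a') (c' - a') \<noteq> 0" using D D' by simp
  have ab: "a \<noteq> b" using D by (auto simp: cross_def)
  show "rho 1 (tri a b c) < rho 1 (steiner q v (tri a b c))" if "dist c a \<noteq> dist c b"
  proof -
    have "0 < ((dist c a)\<^sup>2 - (dist c b)\<^sup>2)\<^sup>2 / (2 * (dist a b)\<^sup>2)"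
      using that ab by simp
    then have "side_sum a' b' c' < side_sum a b c"
      unfolding side_sum_def d(1) using diff by linarith
    then show ?thesis
      unfolding st rho_tri[OF D] rho_tri[OF D0] D' using D side_sum_pos[OF D] side_sum_pos[OF D0]
      by (intro divide_strict_left_mono) auto
  qed
  show "congruent_sets (steiner q v (tri a b c)) (tri a b c)" if "dist c a = dist c b"
  proof -
    have "(dist b' c')\<^sup>2 = (dist b c)\<^sup>2"
      using diff that d(2) by (simp add: dist_commute)
    then have "dist b' c' = dist b c" by simp
    then show ?thesis unfolding st
      using d that ab by (intro congruent_sets_tri) (auto simp: dist_commute)
  qed
qed

section \<open>Comparison with equilateral triangles\<close>

lemma rho_congruent_triangles:
  assumes "is_triangle T" and "congruent_sets T E"
  shows "rho 1 T = rho 1 E"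
proof -
  from assms(1) obtain a b c where D: "cross (b - a) (c - a) \<noteq> 0" and T: "T = tri a b c"
    unfolding is_triangle_def collinear_iff_cross by blast
  from assms(2) obtain f where f: "\<And>x y. dist (f x) (f y) = dist x y" and E: "f ` T = E"
    unfolding congruent_sets_def by blast
  have E: "E = tri (f a) (f b) (f c)" using isometry_image_tri[OF f] E T by simp
  have "(cross (f b - f a) (f c - f a))\<^sup>2 = (cross (b - a) (c - a))\<^sup>2"
    by (rule cross_square_cong) (simp_all add: f)
  then have "\<bar>cross (f b - f a) (f c - f a)\<bar> = \<bar>cross (b - a) (c - a)\<bar>"
    by (simp add: power2_eq_iff abs_eq_iff)
  moreover have "cross (f b - f a) (f c - f a) \<noteq> 0" using calculation D by auto
  ultimately show ?thesis
    unfolding T E by (simp only: rho_tri D side_sum_def f not_False_eq_True)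
qed

lemma ex_equilateral_triangle:
  assumes "0 < A"
  shows "\<exists>E. equilateral_triangle E \<and> area E = A"
proof -
  \<comment> \<open>An equilateral triangle of side \<open>l\<close> has area
    \<open>sqrt 3 / 4 * l\<^sup>2\<close>.\<close>
  define l where "l = sqrt (4 * A / sqrt 3)"
  have l: "0 < l" "l\<^sup>2 = 4 * A / sqrt 3" using assms by (simp_all add: l_def)
  define b c where "b = Complex l 0" and "c = Complex (l / 2) (l * sqrt 3 / 2)"
  have cr: "cross (b - 0) (c - 0) = 2 * A"
  proof -
    have "cross (b - 0) (c - 0) = l\<^sup>2 * sqrt 3 / 2"
      by (simp add: cross_def b_def c_def power2_eq_square)
    then show ?thesis unfolding l(2) by simp
  qed
  have "(dist 0 b)\<^sup>2 = l\<^sup>2" "(dist b c)\<^sup>2 = l\<^sup>2" "(dist c 0)\<^sup>2 = l\<^sup>2"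
    unfolding dist_norm cmod_power2 b_def c_def
    by (simp_all add: power2_eq_square field_simps)
  then have "(dist 0 b)\<^sup>2 = (dist b c)\<^sup>2" "(dist b c)\<^sup>2 = (dist c 0)\<^sup>2" by simp_all
  then have "dist 0 b = dist b c" "dist b c = dist c 0" by (auto simp only: power2_eq_iff_nonneg zero_le_dist)
  moreover have "\<not> collinear {0, b, c}"
    using cr assms unfolding collinear_iff_cross by simp
  moreover have "area (tri 0 b c) = A"
    using area_tri[of b 0 c] cr assms by simp
  ultimately show ?thesis unfolding equilateral_triangle_def by blast
qed

text \<open>Equal areas give equal \<open>\<bar>cross\<bar>\<close>, and \<open>E\<close> attains
  the lower bound for \<open>side_sum\<close>. Equality for \<open>T\<close> makes it equilateral
  too, with the same side length because the sums agree.\<close>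

lemma rho_equilateral_max:
  assumes E: "equilateral_triangle E" and T: "is_triangle T" and area: "area T = area E"
  shows "rho 1 T \<le> rho 1 E" and "rho 1 T = rho 1 E \<longleftrightarrow> congruent_sets T E"
proof -
  obtain a b c where D: "cross (b - a) (c - a) \<noteq> 0" and eq: "dist a b = dist b c" "dist b c = dist c a"
    and E: "E = tri a b c"
    using E unfolding equilateral_triangle_def collinear_iff_cross by blast
  obtain a' b' c' where D': "cross (b' - a') (c' - a') \<noteq> 0" and T': "T = tri a' b' c'"
    using T unfolding is_triangle_def collinear_iff_cross by blast
  have DD: "\<bar>cross (b' - a') (c' - a')\<bar> = \<bar>cross (b - a) (c - a)\<bar>"
    using area unfolding E T' by (simp add: area_tri D D')
  have S: "side_sum a b c = sqrt 12 * \<bar>cross (b - a) (c - a)\<bar>"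
    using eq side_sum_eq_iff by blast
  have S': "side_sum a b c \<le> side_sum a' b' c'"
    using side_sum_ge[of b' a' c'] unfolding S DD .
  show "rho 1 T \<le> rho 1 E"
    unfolding T' E rho_tri[OF D] rho_tri[OF D'] DD
    using S' side_sum_pos[OF D] side_sum_pos[OF D'] by (intro divide_left_mono) auto
  show "rho 1 T = rho 1 E \<longleftrightarrow> congruent_sets T E"
  proof
    assume "rho 1 T = rho 1 E"
    then have SS: "side_sum a' b' c' = side_sum a b c"
      unfolding T' E rho_tri[OF D] rho_tri[OF D'] DD
      using D side_sum_pos[OF D] side_sum_pos[OF D'] by (simp add: field_simps)
    then have eq': "dist a' b' = dist b' c'" "dist b' c' = dist c' a'"
      using side_sum_eq_iff[of a' b' c'] unfolding S DD by simp_all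
    have "(dist c' a')\<^sup>2 = (dist c a)\<^sup>2"
      using SS unfolding side_sum_def eq eq' by simp
    then have "dist c' a' = dist c a" by simp
    moreover have "a' \<noteq> b'" using D' by (auto simp: cross_def)
    ultimately show "congruent_sets T E"
      unfolding T' E using eq eq' by (intro congruent_sets_tri) auto
  qed (rule rho_congruent_triangles[OF T])
qed

theorem corollary2p8:
  shows "(\<forall>a b c q v. \<not> collinear {a, b, c} \<and> area (tri a b c) = 1 \<and> v \<noteq> 0 \<and> v \<bullet> (b - a) = 0 \<longrightarrow>
            (dist c a \<noteq> dist c b \<longrightarrow> rho 1 (steiner q v (tri a b c)) > rho 1 (tri a b c)) \<and>
            (dist c a = dist c b \<longrightarrow> congruent_sets (steiner q v (tri a b c)) (tri a b c))) \<and>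
         (\<forall>A>0. (\<exists>E. equilateral_triangle E \<and> area E = A) \<and>
            (\<forall>E. equilateral_triangle E \<and> area E = A \<longrightarrow>
               (\<forall>T. is_triangle T \<and> area T = A \<longrightarrow>
                  rho 1 T \<le> rho 1 E \<and> (rho 1 T = rho 1 E \<longleftrightarrow> congruent_sets T E))))"
  using rho_steiner_triangle ex_equilateral_triangle rho_equilateral_max
  by (simp add: collinear_iff_cross)

end
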